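(* Consider the two-way relay status update system with sources $S_A,S_B$ described in the context, let $i\in\{A,B\}$, let $T=T_1+T_2>0$ be the duration of one transmission cycle, and let $\varphi_i\in(0,1]$ be the overall transmission success probability at $S_i$ in one cycle. Then the average age of information (AAoI) at $S_i$, i.e. the (almost sure) limit $\Delta_i^{AAOI}=\lim_{T_c\to\infty}\frac{1}{T_c}\int_0^{T_c}\Delta_i(t)\,dt$, is $$\Delta_i^{AAOI}=\frac{T}{2}+\frac{T}{\varphi_i}.$$
   Context: Two sources $S_A,S_B$ exchange status updates through a decode-and-forward relay $R$. Time is divided into consecutive transmission cycles of duration $T=T_1+T_2$, where $T_1>0$ is the duration of the first slot (sources to relay) and $T_2>0$ that of the second slot (relay to sources). Updates follow the generate-at-will model: at the start of every cycle, at times $0,T,2T,\dots$, each source generates a fresh update and transmits it. If it is successfully delivered, it is received by the opposite source at the end of the same cycle (so every delivered update has end-to-end delay exactly $T$); otherwise it is lost. For $i\in\{A,B\}$ let $i'$ be the other element of $\{A,B\}$. The update of $S_{i'}$ sent in a given cycle is received successfully at $S_i$ with probability $\varphi_i=1-\left(\varepsilon^{i'}_R+(1-\varepsilon^{i'}_R)\varepsilon^R_i\right)$, where $\varepsilon^{i'}_R$ is the decoding error probability at the relay for the block from $S_{i'}$ and $\varepsilon^R_i$ is the decoding error probability at $S_i$ for the block from the relay. Successes in different cycles are independent, so the time $X_i$ between two consecutive successfully received updates at $S_i$ is $T$ times a geometric random variable (on $\{1,2,\dots\}$) with success probability $\varphi_i$. The age of information at $S_i$ at time $t$ is $\Delta_i(t)=t-g(t)$,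 where $g(t)$ is the generation time of the freshest update received at $S_i$ by time $t$. Thus $\Delta_i$ starts from some finite initial value $\Delta_i(0)=\Delta_0\ge 0$, increases linearly with slope $1$, and is reset to $T$ at the end of each cycle in which the update is successfully delivered. *)

theory Defs
  imports "HOL-Probability.Probability"
begin

datatype source = A | B

fun opposite :: "source \<Rightarrow> source" where
  "opposite A = B"
| "opposite B = A"

(* epsR j: probability of a decoding error at the relay for the block from source j;
   epsS i: probability of a decoding error at source i for the block from the relay. *)
definition success_prob :: "(source \<Rightarrow> real) \<Rightarrow> (source \<Rightarrow> real) \<Rightarrow> source \<Rightarrow> real" where
  "success_prob epsR epsS i =
     1 - (epsR (opposite i) + (1 - epsR (opposite i)) * epsS i)"

(* D is the set of cycles whose update is delivered.  The update of cycle k is generated at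
   time k * T and, if delivered, received at time (k + 1) * T.  The initial age d0 is the age
   of an update generated at time -d0 and already held at time 0, so for T > 0 the maximum
   is over a finite nonempty set. *)
definition freshest :: "real \<Rightarrow> real \<Rightarrow> nat set \<Rightarrow> real \<Rightarrow> real" where
  "freshest T d0 D t =
     Max (insert (- d0) {real k * T |k. k \<in> D \<and> real (k + 1) * T \<le> t})"

definition age :: "real \<Rightarrow> real \<Rightarrow> nat set \<Rightarrow> real \<Rightarrow> real" where
  "age T d0 D t = t - freshest T d0 D t"

(* delivered i k: the event that the update sent in cycle k by the source opposite to i is
   received at i.  Independence is required across cycles only; the deliveries at A and at B
   may depend on each other. *)
locale two_way_relay = prob_space M for M :: "'w measure" +
  fixes T1 T2 :: real
    and epsR epsS :: "source \<Rightarrow> real"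
    and delivered :: "source \<Rightarrow> nat \<Rightarrow> 'w set"
    and d0 :: "source \<Rightarrow> real"
  assumes T1_pos: "T1 > 0"
    and T2_pos: "T2 > 0"
    and epsR_range: "epsR j \<in> {0..1}"
    and epsS_range: "epsS j \<in> {0..1}"
    and delivered_indep: "indep_events (delivered j) UNIV"
    and delivered_prob: "prob (delivered j k) = success_prob epsR epsS j"
    and d0_nonneg: "d0 j \<ge> 0"

end

theory Submission
  imports Defs "HOL-Real_Asymp.Real_Asymp"
begin

text \<open>
  Let \<open>a\<^sub>n\<close> be the age at time \<open>n T\<close> and \<open>X\<^sub>n\<close> the indicator of delivery in cycle \<open>n\<close>, so that
  \<open>a\<^sub>n\<^sub>+\<^sub>1 = a\<^sub>n + T - X\<^sub>n a\<^sub>n\<close>, and the age integrates to \<open>T a\<^sub>n + T\<^sup>2 / 2\<close> over cycle \<open>n\<close>. Summing the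
  recursion expresses the average of the \<open>a\<^sub>n\<close> over \<open>n < N\<close> as \<open>T / \<phi>\<close> up to multiples of \<open>1 / N\<close>,
  \<open>a\<^sub>N / N\<close> and \<open>S\<^sub>N / N\<close>, where \<open>S\<^sub>N\<close> sums the orthogonal increments \<open>(X\<^sub>n - \<phi>) a\<^sub>n\<close>.
  As \<open>a\<^sub>n\<close> is bounded in mean square, \<open>E (a\<^sub>N + S\<^sub>N)\<^sup>2 = O(N)\<close>, whence almost sure convergence along
  \<open>N = k\<^sup>2\<close>. The integral of the nonnegative age is monotone, which fills the gaps between squares.
\<close>

section \<open>Deterministic analysis of the age\<close>

primrec cycle_age :: "real \<Rightarrow> real \<Rightarrow> nat set \<Rightarrow> nat \<Rightarrow> real" where
  "cycle_age T d D 0 = d"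
| "cycle_age T d D (Suc n) = (if n \<in> D then T else cycle_age T d D n + T)"

lemma cycle_age_nonneg: "T \<ge> 0 \<Longrightarrow> d \<ge> 0 \<Longrightarrow> cycle_age T d D n \<ge> 0"
  by (induction n) auto

text \<open>Ties the recursion to \<open>freshest\<close>. A delivery in cycle \<open>n\<close>
  inserts the generation time \<open>n * T\<close>, which beats every earlier candidate because the
  age is nonnegative; without a delivery the set stays the same.\<close>

lemma Max_cycle_age:
  assumes "T > 0" "d \<ge> 0"
  shows "Max (insert (- d) {real k * T |k. k \<in> D \<and> k < n}) = real n * T - cycle_age T d D n"
proof (induction n)
  case 0
  then show ?case by simp
next
  case (Suc n)
  let ?S = "\<lambda>n. {real k * T |k. k \<in> D \<and> k < n}"
  have fin: "finite (insert (- d) (?S n))" by simp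
  show ?case
  proof (cases "n \<in> D")
    case True
    have "insert (- d) (?S (Suc n)) = insert (real n * T) (insert (- d) (?S n))"
      using True by (auto simp: less_Suc_eq)
    moreover have "Max (insert (- d) (?S n)) \<le> real n * T"
      unfolding Suc.IH using cycle_age_nonneg[of T d D n] assms by simp
    ultimately show ?thesis
      using fin True by (simp add: Max_insert[OF fin] algebra_simps)
  next
    case False
    then have "?S (Suc n) = ?S n" by (auto simp: less_Suc_eq)
    then show ?thesis using Suc.IH False by (simp add: algebra_simps)
  qed
qed

lemma age_in_cycle:
  assumes "T > 0" "d \<ge> 0" "real n * T \<le> t" "t < real (Suc n) * T"
  shows "age T d D t = cycle_age T d D n + (t - real n * T)"
proof -
  \<comment> \<open>An update arrives only at the end of its cycle, so during cycle \<open>n\<close>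
    exactly the updates of cycles below \<open>n\<close> can have been received.\<close>
  have "real (k + 1) * T \<le> t \<longleftrightarrow> k < n" for k
  proof
    assume "real (k + 1) * T \<le> t"
    then have "real (k + 1) * T < real (Suc n) * T" using assms by linarith
    then show "k < n" using assms by simp
  next
    assume "k < n"
    then have "real (k + 1) * T \<le> real n * T" using assms by (intro mult_right_mono) auto
    then show "real (k + 1) * T \<le> t" using assms by linarith
  qed
  then show ?thesis
    unfolding age_def freshest_def by (simp only: Max_cycle_age[OF assms(1,2)])
qed

lemma age_nonneg:
  assumes "T > 0" "d \<ge> 0" "t \<ge> 0"
  shows "age T d D t \<ge> 0"
proof -
  define n where "n = nat \<lfloor>t / T\<rfloor>"
  have "real n \<le> t / T" "t / T < real (Suc n)"
    unfolding n_def using assms by (simp_all add: of_nat_nat) linarith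
  then have "real n * T \<le> t" "t < real (Suc n) * T"
    using assms by (simp_all add: field_simps)
  then show ?thesis
    using age_in_cycle[of T d n t D] cycle_age_nonneg[of T d D n] assms by simp
qed

lemma has_integral_age_cycle:
  assumes "T > 0" "d \<ge> 0"
  shows "(age T d D has_integral (T * cycle_age T d D n + T\<^sup>2 / 2)) {real n * T..real (Suc n) * T}"
proof -
  let ?a = "real n * T" and ?b = "real (Suc n) * T" and ?c = "cycle_age T d D n"
  have ab: "?a \<le> ?b" using assms by (simp add: algebra_simps)
  have "((\<lambda>t. (?c - ?a) + t) has_integral (?b - ?a) *\<^sub>R (?c - ?a) + (?b\<^sup>2 - ?a\<^sup>2) / 2) {?a..?b}"
    by (intro has_integral_add ident_has_integral ab)
       (use has_integral_const_real[of "?c - ?a" ?a ?b] ab in simp)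
  moreover have "(?b - ?a) *\<^sub>R (?c - ?a) + (?b\<^sup>2 - ?a\<^sup>2) / 2 = T * ?c + T\<^sup>2 / 2"
    by (simp add: field_simps power2_eq_square)
  ultimately have "((\<lambda>t. (?c - ?a) + t) has_integral (T * ?c + T\<^sup>2 / 2)) {?a..?b}"
    by simp
  \<comment> \<open>At the right endpoint the age may already have been reset; this single point
    does not affect the integral.\<close>
  then show ?thesis
    by (rule has_integral_spike_finite[of "{?b}", rotated 2])
       (use age_in_cycle[OF assms, of n] in auto)
qed

lemma has_integral_age:
  assumes "T > 0" "d \<ge> 0"
  shows "(age T d D has_integral (T * (\<Sum>n<N. cycle_age T d D n) + real N * T\<^sup>2 / 2)) {0..real N * T}"
proof (induction N)
  case 0
  then show ?case using has_integral_refl(2)[of "age T d D" 0] by simp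
next
  case (Suc N)
  have "(age T d D has_integral (T * (\<Sum>n<N. cycle_age T d D n) + real N * T\<^sup>2 / 2)
      + (T * cycle_age T d D N + T\<^sup>2 / 2)) {0..real (Suc N) * T}"
    using assms
    by (intro has_integral_combine[OF _ _ Suc.IH has_integral_age_cycle]) auto
  then show ?case by (simp add: algebra_simps add_divide_distrib)
qed

lemma age_integrable_on:
  assumes "T > 0" "d \<ge> 0"
  shows "age T d D integrable_on {0..t}"
proof -
  obtain N where "t / T \<le> real N" using real_arch_simple by blast
  then have "t \<le> real N * T" using assms by (simp add: field_simps)
  moreover have "age T d D integrable_on {0..real N * T}"
    using has_integral_age[OF assms] by blast
  ultimately show ?thesis by (auto intro: integrable_on_subinterval)
qed

section \<open>Passage from square times to continuous time\<close>

text \<open>With \<open>k\<close> the floor of \<open>sqrt x\<close>, monotonicity squeezes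
  \<open>G x\<close> between its values at the squares of \<open>k\<close> and \<open>Suc k\<close>,
  and both squares divided by \<open>x\<close> tend to 1.\<close>

lemma tendsto_over_self_of_squares:
  fixes G :: "real \<Rightarrow> real"
  assumes mono: "\<And>x y. 0 \<le> x \<Longrightarrow> x \<le> y \<Longrightarrow> G x \<le> G y"
    and sq: "(\<lambda>k. G ((real k)\<^sup>2) / (real k)\<^sup>2) \<longlonglongrightarrow> L"
  shows "((\<lambda>x. G x / x) \<longlongrightarrow> L) at_top"
proof -
  define k where "k = (\<lambda>x::real. nat \<lfloor>sqrt x\<rfloor>)"
  have k: "filterlim k at_top at_top"
    unfolding k_def
    by (intro filterlim_compose[OF filterlim_nat_sequentially]
        filterlim_compose[OF filterlim_floor_sequentially] sqrt_at_top)
  then have k': "filterlim (\<lambda>x. Suc (k x)) at_top at_top"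
    by (rule filterlim_compose[OF filterlim_Suc])
  have fl: "real (k x) = of_int \<lfloor>sqrt x\<rfloor>" if "x \<ge> 0" for x
    using that by (simp add: k_def)
  have l1: "((\<lambda>x. (real (k x))\<^sup>2 / x) \<longlongrightarrow> 1) at_top"
  proof (rule Lim_transform_eventually)
    show "((\<lambda>x::real. (of_int \<lfloor>sqrt x\<rfloor>)\<^sup>2 / x) \<longlongrightarrow> 1) at_top" by real_asymp
    show "\<forall>\<^sub>F x in at_top. (of_int \<lfloor>sqrt x\<rfloor>)\<^sup>2 / x = (real (k x))\<^sup>2 / x"
      using eventually_ge_at_top[of 0] by eventually_elim (simp add: fl)
  qed
  have l2: "((\<lambda>x. (real (Suc (k x)))\<^sup>2 / x) \<longlongrightarrow> 1) at_top"
  proof (rule Lim_transform_eventually)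
    show "((\<lambda>x::real. (1 + of_int \<lfloor>sqrt x\<rfloor>)\<^sup>2 / x) \<longlongrightarrow> 1) at_top" by real_asymp
    show "\<forall>\<^sub>F x in at_top. (1 + of_int \<lfloor>sqrt x\<rfloor>)\<^sup>2 / x = (real (Suc (k x)))\<^sup>2 / x"
      using eventually_ge_at_top[of 0] by eventually_elim (simp add: fl)
  qed
  have L1: "((\<lambda>x. G ((real (k x))\<^sup>2) / (real (k x))\<^sup>2 * ((real (k x))\<^sup>2 / x)) \<longlongrightarrow> L) at_top"
    using tendsto_mult[OF filterlim_compose[OF sq k] l1] by simp
  have L2: "((\<lambda>x. G ((real (Suc (k x)))\<^sup>2) / (real (Suc (k x)))\<^sup>2 * ((real (Suc (k x)))\<^sup>2 / x)) \<longlongrightarrow> L) at_top"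
    using tendsto_mult[OF filterlim_compose[OF sq k'] l2] by simp
  have bounds: "(real (k x))\<^sup>2 \<le> x" "x \<le> (real (Suc (k x)))\<^sup>2" if "x \<ge> 1" for x
  proof -
    have "real (k x) \<le> sqrt x" "sqrt x \<le> real (Suc (k x))"
      using that by (simp_all add: fl) linarith
    then have "(real (k x))\<^sup>2 \<le> (sqrt x)\<^sup>2" "(sqrt x)\<^sup>2 \<le> (real (Suc (k x)))\<^sup>2"
      using that by (intro power_mono; simp)+
    then show "(real (k x))\<^sup>2 \<le> x" "x \<le> (real (Suc (k x)))\<^sup>2" using that by simp_all
  qed
  have ev: "\<forall>\<^sub>F x in at_top. x \<ge> 1 \<and> k x \<ge> 1"
    using k eventually_ge_at_top[of "1::real"] by (auto simp: filterlim_at_top intro: eventually_conj)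
  show ?thesis
  proof (rule tendsto_sandwich[OF _ _ L1 L2])
    show "\<forall>\<^sub>F x in at_top. G ((real (k x))\<^sup>2) / (real (k x))\<^sup>2 * ((real (k x))\<^sup>2 / x) \<le> G x / x"
      using ev
    proof eventually_elim
      case (elim x)
      then show ?case using mono[OF _ bounds(1)[of x]] by (simp add: divide_right_mono)
    qed
    show "\<forall>\<^sub>F x in at_top. G x / x \<le> G ((real (Suc (k x)))\<^sup>2) / (real (Suc (k x)))\<^sup>2 * ((real (Suc (k x)))\<^sup>2 / x)"
      using ev
    proof eventually_elim
      case (elim x)
      then show ?case
        using mono[OF _ bounds(2)[of x]] by (simp add: divide_right_mono del: of_nat_Suc)
    qed
  qed
qed

lemma average_age_tendsto:
  assumes "T > 0" "d \<ge> 0"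
    and lim: "(\<lambda>k. (\<Sum>n<k\<^sup>2. cycle_age T d D n) / real (k\<^sup>2)) \<longlonglongrightarrow> L"
  shows "((\<lambda>t. 1 / t * integral {0..t} (age T d D)) \<longlongrightarrow> T / 2 + L) at_top"
proof -
  \<comment> \<open>Time is counted in cycles, so that \<open>G\<close> at a square integrates over
    whole cycles and \<open>has_integral_age\<close> applies.\<close>
  define G where "G = (\<lambda>x. integral {0..x * T} (age T d D))"
  have "((\<lambda>x. G x / x) \<longlongrightarrow> T * L + T\<^sup>2 / 2) at_top"
  proof (rule tendsto_over_self_of_squares)
    show "G x \<le> G y" if "0 \<le> x" "x \<le> y" for x y
      unfolding G_def using that assms
      by (intro integral_subset_le age_integrable_on) (auto intro: age_nonneg mult_right_mono)
    have "(\<lambda>k. T * ((\<Sum>n<k\<^sup>2. cycle_age T d D n) / real (k\<^sup>2)) + T\<^sup>2 / 2) \<longlonglongrightarrow> T * L + T\<^sup>2 / 2"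
      by (intro tendsto_intros lim)
    moreover have "\<forall>\<^sub>F k in sequentially. T * ((\<Sum>n<k\<^sup>2. cycle_age T d D n) / real (k\<^sup>2)) + T\<^sup>2 / 2
        = G ((real k)\<^sup>2) / (real k)\<^sup>2"
      \<comment> \<open>At \<open>k = 0\<close> the identity fails: division by zero gives 0 on the
        right, while the constant term survives on the left.\<close>
      using eventually_gt_at_top[of 0]
    proof eventually_elim
      case (elim k)
      have "G ((real k)\<^sup>2) = T * (\<Sum>n<k\<^sup>2. cycle_age T d D n) + (real k)\<^sup>2 * T\<^sup>2 / 2"
        using integral_unique[OF has_integral_age[OF assms(1,2), of D "k\<^sup>2"]] by (simp add: G_def)
      then show ?case using elim by (simp add: add_divide_distrib)
    qed
    ultimately show "(\<lambda>k. G ((real k)\<^sup>2) / (real k)\<^sup>2) \<longlonglongrightarrow> T * L + T\<^sup>2 / 2"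
      by (rule Lim_transform_eventually)
  qed
  moreover have "filterlim (\<lambda>t. t / T) at_top at_top"
    using assms by real_asymp
  ultimately have "((\<lambda>t. G (t / T) / (t / T)) \<longlongrightarrow> T * L + T\<^sup>2 / 2) at_top"
    by (rule filterlim_compose)
  then have "((\<lambda>t. G (t / T) / (t / T) / T) \<longlongrightarrow> (T * L + T\<^sup>2 / 2) / T) at_top"
    using assms by (intro tendsto_divide) auto
  moreover have "(T * L + T\<^sup>2 / 2) / T = T / 2 + L"
    using assms by (simp add: field_simps power2_eq_square)
  ultimately show ?thesis using assms by (simp add: G_def)
qed

definition centred_sum :: "real \<Rightarrow> real \<Rightarrow> real \<Rightarrow> nat set \<Rightarrow> nat \<Rightarrow> real" where
  "centred_sum T d p D N = (\<Sum>n<N. (of_bool (n \<in> D) - p) * cycle_age T d D n)"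

text \<open>Telescopes the recursion: the age lost to a reset in cycle \<open>n\<close> is split
  into \<open>p\<close> times the age and a centred increment. Solved for the sum of ages, it yields
  the average.\<close>

lemma cycle_age_plus_centred_sum:
  "cycle_age T d D N + centred_sum T d p D N = d + real N * T - p * (\<Sum>n<N. cycle_age T d D n)"
  by (induction N) (auto simp: centred_sum_def algebra_simps)

section \<open>Second moments\<close>

definition depends_below :: "nat \<Rightarrow> (nat set \<Rightarrow> 'a) \<Rightarrow> bool" where
  "depends_below N h \<longleftrightarrow> (\<forall>D. h (D \<inter> {..<N}) = h D)"

lemma cycle_age_Int: "n \<le> N \<Longrightarrow> cycle_age T d (D \<inter> {..<N}) n = cycle_age T d D n"
  by (induction n) auto

lemma centred_sum_Int:
  "n \<le> N \<Longrightarrow> centred_sum T d p (D \<inter> {..<N}) n = centred_sum T d p D n"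
  unfolding centred_sum_def by (intro sum.cong) (auto simp: cycle_age_Int)

text \<open>\<open>K / p\<close> is the fixed point of the map \<open>x\<close> to
  \<open>K + (1 - p) * x\<close>, and the excess \<open>u 0\<close> over it can only shrink.\<close>

lemma affine_recursion_bound:
  fixes u :: "nat \<Rightarrow> real"
  assumes "0 < p" "p \<le> 1" "u 0 \<ge> 0" "K \<ge> 0" and step: "\<And>n. u (Suc n) \<le> K + (1 - p) * u n"
  shows "u n \<le> u 0 + K / p"
proof (induction n)
  case 0
  then show ?case using assms by simp
next
  case (Suc n)
  have "u (Suc n) \<le> K + (1 - p) * (u 0 + K / p)"
    using step[of n] mult_left_mono[OF Suc.IH, of "1 - p"] assms by linarith
  also have "\<dots> = u 0 + K / p - p * u 0" using assms by (simp add: field_simps)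
  also have "\<dots> \<le> u 0 + K / p" using assms by simp
  finally show ?case .
qed

text \<open>Borel-Cantelli in integral form: the sum of all \<open>Y k\<close> has finite integral,
  hence is finite almost everywhere, and the terms of a convergent series vanish.\<close>

lemma AE_tendsto_zero_of_summable_integral:
  fixes Y :: "nat \<Rightarrow> 'a \<Rightarrow> real"
  assumes int: "\<And>k. integrable M (Y k)" and nonneg: "\<And>k x. Y k x \<ge> 0"
    and sum: "summable (\<lambda>k. \<integral>x. Y k x \<partial>M)"
  shows "AE x in M. (\<lambda>k. Y k x) \<longlonglongrightarrow> 0"
proof -
  have [measurable]: "Y k \<in> borel_measurable M" for k using int by blast
  have "(\<integral>\<^sup>+x. (\<Sum>k. ennreal (Y k x)) \<partial>M) = (\<Sum>k. \<integral>\<^sup>+x. ennreal (Y k x) \<partial>M)"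
    by (intro nn_integral_suminf) measurable
  also have "\<dots> = (\<Sum>k. ennreal (\<integral>x. Y k x \<partial>M))"
    using int nonneg by (simp add: nn_integral_eq_integral)
  also have "\<dots> \<noteq> \<infinity>"
    unfolding infinity_ennreal_def
    by (intro ennreal_suminf_neq_top sum Bochner_Integration.integral_nonneg nonneg)
  finally have "AE x in M. (\<Sum>k. ennreal (Y k x)) \<noteq> \<infinity>"
    by (intro nn_integral_PInf_AE) measurable
  then show ?thesis
  proof eventually_elim
    case (elim x)
    then have "summable (\<lambda>k. Y k x)"
      unfolding infinity_ennreal_def by (intro summable_suminf_not_top nonneg)
    then show ?case by (rule summable_LIMSEQ_zero)
  qed
qed

section \<open>Independence of each cycle from its past\<close>

context prob_space
begin

text \<open>A singleton family is closed under intersection, so independence of the events extends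
  to the sigma algebras they generate, which contain all preimages under the membership tests. As
  random variables they can be grouped into blocks.\<close>

lemma indep_vars_mem:
  assumes "indep_events F I"
  shows "indep_vars (\<lambda>_. count_space UNIV) (\<lambda>k w. w \<in> F k) I"
proof -
  have ev: "F k \<in> events" if "k \<in> I" for k using assms that by (auto simp: indep_events_def)
  have "indep_sets (\<lambda>k. sigma_sets (space M) {F k}) I"
    using assms by (intro indep_sets_sigma) (auto simp: indep_events_def_alt Int_stable_def)
  moreover have "{(\<lambda>w. w \<in> F k) -` A \<inter> space M |A. A \<in> sets (count_space UNIV)}
      \<subseteq> sigma_sets (space M) {F k}" if k: "k \<in> I" for k
  proof safe
    fix A :: "bool set"
    have sub: "F k \<subseteq> space M" using ev[OF k] by (rule sets.sets_into_space)
    have F: "F k \<in> sigma_sets (space M) {F k}" by auto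
    have "A \<in> Pow UNIV" by simp
    then consider "A = {}" | "A = {True}" | "A = {False}" | "A = UNIV"
      by (auto simp: UNIV_bool Pow_insert)
    then have "(\<lambda>w. w \<in> F k) -` A \<inter> space M \<in> {{}, space M, F k, space M - F k}"
      by cases (use sub in auto)
    then show "(\<lambda>w. w \<in> F k) -` A \<inter> space M \<in> sigma_sets (space M) {F k}"
      using F sigma_sets.Compl[OF F] by (auto intro: sigma_sets.Empty sigma_sets_top)
  qed
  ultimately have "indep_sets (\<lambda>k. {(\<lambda>w. w \<in> F k) -` A \<inter> space M |A. A \<in> sets (count_space UNIV)}) I"
    by (rule indep_sets_mono_sets)
  moreover have "(\<lambda>w. w \<in> F k) \<in> M \<rightarrow>\<^sub>M count_space UNIV" if "k \<in> I" for k
    using ev[OF that] by measurable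
  ultimately show ?thesis by (simp add: indep_vars_def2)
qed

context
  fixes F :: "nat \<Rightarrow> 'a set" and p :: real
  assumes indep: "indep_events F UNIV" and prob_F: "\<And>k. prob (F k) = p"
begin

abbreviation (input) hits :: "'a \<Rightarrow> nat set" where
  "hits w \<equiv> {k. w \<in> F k}"

lemma F_events [measurable]: "F k \<in> events"
  using indep by (auto simp: indep_events_def)

text \<open>Factors \<open>h\<close> through the finite tuple of outcomes below \<open>N\<close>,
  the form to which product measurability and block independence apply.\<close>

lemma depends_below_restrict:
  assumes "depends_below N h"
  shows "h {k. k < N \<and> (\<lambda>k\<in>{..<N}. w \<in> F k) k} = h (hits w)"
proof -
  have "{k. k < N \<and> (\<lambda>k\<in>{..<N}. w \<in> F k) k} = hits w \<inter> {..<N}" by auto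
  then show ?thesis using assms by (simp add: depends_below_def)
qed

text \<open>Finitely many Boolean outcomes form a discrete space, so \<open>h\<close> is measurable;
  it takes finitely many values, so it is bounded.\<close>

lemma integrable_depends_below:
  fixes h :: "nat set \<Rightarrow> real"
  assumes "depends_below N h"
  shows "integrable M (\<lambda>w. h (hits w))"
proof (rule integrable_const_bound)
  have "(\<lambda>w. \<lambda>k\<in>{..<N}. w \<in> F k) \<in> M \<rightarrow>\<^sub>M PiM {..<N} (\<lambda>_. count_space (UNIV :: bool set))"
    by (intro measurable_restrict) measurable
  then have "(\<lambda>w. (\<lambda>x. h {k. k < N \<and> x k}) (\<lambda>k\<in>{..<N}. w \<in> F k)) \<in> borel_measurable M"
    by (rule measurable_compose) (simp add: count_space_PiM_finite)
  also have "(\<lambda>w. (\<lambda>x. h {k. k < N \<and> x k}) (\<lambda>k\<in>{..<N}. w \<in> F k)) = (\<lambda>w. h (hits w))"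
    by (rule ext) (rule depends_below_restrict[OF assms])
  finally show "(\<lambda>w. h (hits w)) \<in> borel_measurable M" .
  have "norm (h (hits w)) \<le> (\<Sum>J\<in>Pow {..<N}. \<bar>h J\<bar>)" for w
  proof -
    have "\<bar>h (hits w \<inter> {..<N})\<bar> \<le> (\<Sum>J\<in>Pow {..<N}. \<bar>h J\<bar>)"
      by (rule member_le_sum) auto
    then show ?thesis using assms by (simp add: depends_below_def)
  qed
  then show "AE w in M. norm (h (hits w)) \<le> (\<Sum>J\<in>Pow {..<N}. \<bar>h J\<bar>)" by simp
qed

text \<open>The index blocks \<open>{..<N}\<close> and \<open>{N}\<close> are disjoint, so the past
  and the outcome of cycle \<open>N\<close> are independent and the expectation factorises.\<close>

lemma expectation_times_of_bool:
  fixes h :: "nat set \<Rightarrow> real"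
  assumes h: "depends_below N h"
  shows "expectation (\<lambda>w. h (hits w) * of_bool (w \<in> F N)) = p * expectation (\<lambda>w. h (hits w))"
proof -
  let ?P = "\<lambda>I. PiM I (\<lambda>_::nat. count_space (UNIV :: bool set))"
  let ?h = "\<lambda>x. h {k. k < N \<and> x k}" and ?s = "\<lambda>x. of_bool (x N) :: real"
  have "indep_var (?P {..<N}) (\<lambda>w. \<lambda>k\<in>{..<N}. w \<in> F k) (?P {N}) (\<lambda>w. \<lambda>k\<in>{N}. w \<in> F k)"
    by (rule indep_var_restrict[OF indep_vars_mem[OF indep]]) auto
  then have iv: "indep_var borel (?h \<circ> (\<lambda>w. \<lambda>k\<in>{..<N}. w \<in> F k)) borel (?s \<circ> (\<lambda>w. \<lambda>k\<in>{N}. w \<in> F k))"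
    by (rule indep_var_compose) (simp_all add: count_space_PiM_finite)
  have e1: "(?h \<circ> (\<lambda>w. \<lambda>k\<in>{..<N}. w \<in> F k)) = (\<lambda>w. h (hits w))"
    by (rule ext) (simp only: o_apply depends_below_restrict[OF h])
  have e2: "(?s \<circ> (\<lambda>w. \<lambda>k\<in>{N}. w \<in> F k)) = (\<lambda>w. indicator (F N) w)"
    by (auto simp: fun_eq_iff indicator_def)
  have "expectation (\<lambda>w. h (hits w) * indicator (F N) w)
      = expectation (\<lambda>w. h (hits w)) * expectation (indicator (F N))"
    using iv unfolding e1 e2
    by (intro indep_var_lebesgue_integral integrable_depends_below[OF h]
        integrable_const_bound[where B = 1]) auto
  then show ?thesis by (simp add: prob_F indicator_def of_bool_def)
qed

section \<open>Moment bounds for the age and the centred sum\<close>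

context
  fixes T d :: real
  assumes T: "T > 0" and d: "d \<ge> 0" and p: "0 < p" "p \<le> 1"
begin

abbreviation (input) a where "a N w \<equiv> cycle_age T d (hits w) N"
abbreviation (input) S where "S N w \<equiv> centred_sum T d p (hits w) N"

lemma integrable_state [simp, intro]:
  fixes f :: "real \<Rightarrow> real \<Rightarrow> bool \<Rightarrow> real"
  shows "integrable M (\<lambda>w. f (a N w) (S N w) (w \<in> F N))"
proof -
  \<comment> \<open>\<open>Suc N\<close> rather than \<open>N\<close>, since \<open>f\<close> also
    sees the outcome of cycle \<open>N\<close> itself.\<close>
  have "depends_below (Suc N) (\<lambda>D. f (cycle_age T d D N) (centred_sum T d p D N) (N \<in> D))"
    by (simp add: depends_below_def cycle_age_Int centred_sum_Int)
  from integrable_depends_below[OF this] show ?thesis by simp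
qed

lemma expectation_state_times_of_bool:
  fixes f :: "real \<Rightarrow> real \<Rightarrow> real"
  shows "expectation (\<lambda>w. f (a N w) (S N w) * of_bool (w \<in> F N))
    = p * expectation (\<lambda>w. f (a N w) (S N w))"
  by (rule expectation_times_of_bool[of N "\<lambda>D. f (cycle_age T d D N) (centred_sum T d p D N)"])
     (simp add: depends_below_def cycle_age_Int centred_sum_Int)

text \<open>A reset is independent of the current age, so the means obey an affine recursion with
  constant \<open>T\<close> and factor \<open>1 - p\<close>.\<close>

lemma expectation_cycle_age_bound: "expectation (a N) \<le> d + T / p"
proof -
  have "expectation (a (Suc N)) = T + (1 - p) * expectation (a N)" for N
  proof -
    have "expectation (a (Suc N)) = expectation (\<lambda>w. T + a N w - a N w * of_bool (w \<in> F N))"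
      by (intro Bochner_Integration.integral_cong) auto
    also have "\<dots> = T + expectation (a N) - expectation (\<lambda>w. a N w * of_bool (w \<in> F N))"
      using integrable_state[of "\<lambda>x _ _. x" N] integrable_state[of "\<lambda>x _ b. x * of_bool b" N]
      by (simp add: prob_space)
    also have "\<dots> = T + (1 - p) * expectation (a N)"
      using expectation_state_times_of_bool[of "\<lambda>x _. x" N] by (simp add: algebra_simps)
    finally show ?thesis .
  qed
  then show ?thesis
    using affine_recursion_bound[of p "\<lambda>N. expectation (a N)" T N] p T d
    by (simp add: prob_space)
qed

text \<open>The bound of \<open>affine_recursion_bound\<close> for the second moment: initial value
  \<open>d\<^sup>2\<close>, and an additive constant containing the bound on the mean age.\<close>

definition second_moment_bound :: real where
  "second_moment_bound = d\<^sup>2 + (T\<^sup>2 + 2 * T * (d + T / p)) / p"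

lemma second_moment_bound_nonneg: "second_moment_bound \<ge> 0"
  unfolding second_moment_bound_def using T d p by simp

lemma expectation_cycle_age_square_bound: "expectation (\<lambda>w. (a N w)\<^sup>2) \<le> second_moment_bound"
proof -
  have "expectation (\<lambda>w. (a (Suc N) w)\<^sup>2) \<le>
    (T\<^sup>2 + 2 * T * (d + T / p)) + (1 - p) * expectation (\<lambda>w. (a N w)\<^sup>2)" for N
  proof -
    \<comment> \<open>\<open>?g x\<close> is \<open>(T + x)\<^sup>2 - T\<^sup>2\<close>, the amount
      by which a delivery lowers the next squared age.\<close>
    let ?g = "\<lambda>x. 2 * T * x + x\<^sup>2"
    have g: "expectation (\<lambda>w. ?g (a N w)) = 2 * T * expectation (a N) + expectation (\<lambda>w. (a N w)\<^sup>2)"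
      using integrable_state[of "\<lambda>x _ _. x" N] integrable_state[of "\<lambda>x _ _. x\<^sup>2" N] by simp
    have "expectation (\<lambda>w. (a (Suc N) w)\<^sup>2)
        = expectation (\<lambda>w. T\<^sup>2 + ?g (a N w) - ?g (a N w) * of_bool (w \<in> F N))"
      by (intro Bochner_Integration.integral_cong) (auto simp: power2_eq_square algebra_simps)
    also have "\<dots> = T\<^sup>2 + expectation (\<lambda>w. ?g (a N w))
        - expectation (\<lambda>w. ?g (a N w) * of_bool (w \<in> F N))"
      using integrable_state[of "\<lambda>x _ _. ?g x" N] integrable_state[of "\<lambda>x _ b. ?g x * of_bool b" N]
      by (subst Bochner_Integration.integral_diff, simp, simp,
          subst Bochner_Integration.integral_add) (simp_all add: prob_space)
    also have "\<dots> = T\<^sup>2 + (1 - p) * expectation (\<lambda>w. ?g (a N w))"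
      using expectation_state_times_of_bool[of "\<lambda>x _. ?g x" N]
      by (simp add: algebra_simps del: Bochner_Integration.integral_add)
    also have "\<dots> = T\<^sup>2 + (1 - p) * (2 * T * expectation (a N)) + (1 - p) * expectation (\<lambda>w. (a N w)\<^sup>2)"
      unfolding g by (simp add: algebra_simps)
    \<comment> \<open>Replacing the mean age by its uniform bound, and \<open>1 - p\<close> by 1,
      makes the additive constant independent of \<open>N\<close>.\<close>
    also have "(1 - p) * (2 * T * expectation (a N)) \<le> 1 * (2 * T * (d + T / p))"
    proof (rule mult_mono)
      have "0 \<le> expectation (a N)"
        using T d by (intro Bochner_Integration.integral_nonneg cycle_age_nonneg) auto
      then show "0 \<le> 2 * T * expectation (a N)" using T by simp
    qed (use expectation_cycle_age_bound[of N] p T d in auto)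
    finally show ?thesis by simp
  qed
  then show ?thesis
    using affine_recursion_bound[of p "\<lambda>N. expectation (\<lambda>w. (a N w)\<^sup>2)" "T\<^sup>2 + 2 * T * (d + T / p)" N]
      p T d
    by (simp add: prob_space second_moment_bound_def)
qed

lemma expectation_centred_sum_square_bound:
  "expectation (\<lambda>w. (S N w)\<^sup>2) \<le> real N * second_moment_bound"
proof (induction N)
  case 0
  then show ?case by (simp add: centred_sum_def)
next
  case (Suc N)
  let ?x = "\<lambda>w. a N w" and ?s = "\<lambda>w. S N w" and ?b = "\<lambda>w. of_bool (w \<in> F N) :: real"
  \<comment> \<open>Orthogonality: \<open>2 * ?s w * ?x w\<close> depends only on cycles before
    \<open>N\<close>, while \<open>?b w - p\<close> has mean zero and is independent of them. Second
    moments of the increments therefore add up.\<close>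
  have "expectation (\<lambda>w. 2 * ?s w * ?x w * (?b w - p))
      = expectation (\<lambda>w. 2 * ?s w * ?x w * ?b w - p * (2 * ?s w * ?x w))"
    by (simp add: algebra_simps)
  also have "\<dots> = 0"
    using integrable_state[of "\<lambda>x s b. 2 * s * x * of_bool b" N]
      integrable_state[of "\<lambda>x s b. p * (2 * s * x)" N]
      expectation_state_times_of_bool[of "\<lambda>x s. 2 * s * x" N]
    by (subst Bochner_Integration.integral_diff) simp_all
  finally have orth: "expectation (\<lambda>w. 2 * ?s w * ?x w * (?b w - p)) = 0" .
  have "expectation (\<lambda>w. (S (Suc N) w)\<^sup>2)
      = expectation (\<lambda>w. (?s w)\<^sup>2 + 2 * ?s w * ?x w * (?b w - p) + (?x w)\<^sup>2 * (?b w - p)\<^sup>2)"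
    by (intro Bochner_Integration.integral_cong)
       (auto simp: centred_sum_def power2_eq_square algebra_simps)
  also have "\<dots> = expectation (\<lambda>w. (?s w)\<^sup>2) + expectation (\<lambda>w. (?x w)\<^sup>2 * (?b w - p)\<^sup>2)"
    using integrable_state[of "\<lambda>x s b. s\<^sup>2" N]
      integrable_state[of "\<lambda>x s b. 2 * s * x * (of_bool b - p)" N]
      integrable_state[of "\<lambda>x s b. x\<^sup>2 * (of_bool b - p)\<^sup>2" N] orth
    by (subst Bochner_Integration.integral_add, simp, simp, subst Bochner_Integration.integral_add) simp_all
  also have "expectation (\<lambda>w. (?x w)\<^sup>2 * (?b w - p)\<^sup>2) \<le> expectation (\<lambda>w. (?x w)\<^sup>2)"
  proof (rule integral_mono)
    fix w
    have "(?b w - p)\<^sup>2 \<le> 1" using p by (intro power_le_one_iff[THEN iffD2] abs_square_le_1[THEN iffD2]) auto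
    then show "(?x w)\<^sup>2 * (?b w - p)\<^sup>2 \<le> (?x w)\<^sup>2" by (simp add: mult_left_le)
  qed (use integrable_state[of "\<lambda>x s b. x\<^sup>2" N]
      integrable_state[of "\<lambda>x s b. x\<^sup>2 * (of_bool b - p)\<^sup>2" N] in auto)
  finally show ?case
    using Suc.IH expectation_cycle_age_square_bound[of N] by (simp add: algebra_simps)
qed

section \<open>Almost sure convergence along squares\<close>

text \<open>The mean square of the quotient at \<open>N\<close> is of order \<open>1 / N\<close>;
  this is summable along \<open>N = k\<^sup>2\<close>, though not over all \<open>N\<close>.\<close>

lemma AE_remainder_tendsto_zero:
  "AE w in M. (\<lambda>k. (a (k\<^sup>2) w + S (k\<^sup>2) w) / real (k\<^sup>2)) \<longlonglongrightarrow> 0"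
proof -
  let ?C = "second_moment_bound"
  let ?Y = "\<lambda>k w. ((a (k\<^sup>2) w + S (k\<^sup>2) w) / real (k\<^sup>2))\<^sup>2"
  have int: "integrable M (?Y k)" for k
    by (rule integrable_state[of "\<lambda>x s b. ((x + s) / real (k\<^sup>2))\<^sup>2"])
  have bound: "expectation (?Y k) \<le> 4 * ?C * inverse ((real k)\<^sup>2)" if "k \<ge> 1" for k
  proof -
    define N where "N = k\<^sup>2"
    have N: "real N \<ge> 1" using that by (simp add: N_def)
    have "expectation (?Y k) \<le> expectation (\<lambda>w. (2 * (a N w)\<^sup>2 + 2 * (S N w)\<^sup>2) / (real N)\<^sup>2)"
    proof (rule integral_mono[OF int])
      show "integrable M (\<lambda>w. (2 * (a N w)\<^sup>2 + 2 * (S N w)\<^sup>2) / (real N)\<^sup>2)"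
        by (rule integrable_state[of "\<lambda>x s b. (2 * x\<^sup>2 + 2 * s\<^sup>2) / (real N)\<^sup>2"])
      fix w
      have "(a N w + S N w)\<^sup>2 \<le> 2 * (a N w)\<^sup>2 + 2 * (S N w)\<^sup>2"
        using sum_squares_bound[of "a N w" "S N w"] by (simp add: power2_sum)
      then show "?Y k w \<le> (2 * (a N w)\<^sup>2 + 2 * (S N w)\<^sup>2) / (real N)\<^sup>2"
        unfolding N_def[symmetric] by (simp add: power_divide divide_right_mono)
    qed
    also have "\<dots> = (2 * expectation (\<lambda>w. (a N w)\<^sup>2) + 2 * expectation (\<lambda>w. (S N w)\<^sup>2)) / (real N)\<^sup>2"
      using integrable_state[of "\<lambda>x s b. x\<^sup>2" N] integrable_state[of "\<lambda>x s b. s\<^sup>2" N] by simp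
    also have "\<dots> \<le> (4 * ?C * real N) / (real N)\<^sup>2"
    proof (intro divide_right_mono)
      \<comment> \<open>Absorbs the contribution of the age, \<open>2 * ?C\<close>, into the linear
        term, whence the constant 4.\<close>
      have "?C \<le> real N * ?C" using N second_moment_bound_nonneg by (simp add: mult_le_cancel_right1)
      then show "2 * expectation (\<lambda>w. (a N w)\<^sup>2) + 2 * expectation (\<lambda>w. (S N w)\<^sup>2) \<le> 4 * ?C * real N"
        using expectation_cycle_age_square_bound[of N] expectation_centred_sum_square_bound[of N]
        by (simp add: algebra_simps)
    qed simp
    also have "\<dots> = 4 * ?C * inverse ((real k)\<^sup>2)"
      using N by (simp add: field_simps power2_eq_square N_def)
    finally show ?thesis .
  qed
  have "summable (\<lambda>k. 4 * ?C * inverse ((real k)\<^sup>2))"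
    by (intro summable_mult inverse_power_summable) simp
  then have "summable (\<lambda>k. expectation (?Y k))"
    by (rule summable_comparison_test'[where N = 1]) (use bound in \<open>auto simp: integral_nonneg\<close>)
  then have "AE w in M. (\<lambda>k. ?Y k w) \<longlonglongrightarrow> 0"
    using int by (intro AE_tendsto_zero_of_summable_integral) auto
  then show ?thesis
    by eventually_elim simp
qed

lemma AE_average_cycle_age:
  "AE w in M. (\<lambda>k. (\<Sum>n<k\<^sup>2. a n w) / real (k\<^sup>2)) \<longlonglongrightarrow> T / p"
  using AE_remainder_tendsto_zero
proof eventually_elim
  case (elim w)
  have "(\<lambda>k. d / real (k\<^sup>2)) \<longlonglongrightarrow> 0" by real_asymp
  then have "(\<lambda>k. (T + d / real (k\<^sup>2) - (a (k\<^sup>2) w + S (k\<^sup>2) w) / real (k\<^sup>2)) / p) \<longlonglongrightarrow> (T + 0 - 0) / p"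
    using p by (intro tendsto_intros elim) auto
  moreover have "\<forall>\<^sub>F k in sequentially.
      (T + d / real (k\<^sup>2) - (a (k\<^sup>2) w + S (k\<^sup>2) w) / real (k\<^sup>2)) / p = (\<Sum>n<k\<^sup>2. a n w) / real (k\<^sup>2)"
    using eventually_gt_at_top[of 0]
  proof eventually_elim
    case (elim k)
    then show ?case
      \<comment> \<open>Substituting the telescoped identity cancels \<open>T\<close> and
        \<open>d\<close>, leaving \<open>p\<close> times the average; dividing by \<open>p\<close>
        needs \<open>p > 0\<close>.\<close>
      using p unfolding cycle_age_plus_centred_sum by (simp add: field_simps)
  qed
  ultimately show ?case by (simp add: Lim_transform_eventually)
qed

end

end

end

theorem lemma3:
  fixes M :: "'w measure"
    and T1 T2 T phi :: real
    and epsR epsS d0 :: "source \<Rightarrow> real"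
    and delivered :: "source \<Rightarrow> nat \<Rightarrow> 'w set"
    and i :: source
  assumes "two_way_relay M T1 T2 epsR epsS delivered d0"
    and "T = T1 + T2"
    and "phi = success_prob epsR epsS i"
    and "phi \<in> {0<..1}"
  shows "AE w in M.
    ((\<lambda>Tc. 1 / Tc * integral {0..Tc} (age T (d0 i) {k. w \<in> delivered i k}))
       \<longlongrightarrow> T / 2 + T / phi) at_top"
proof -
  interpret two_way_relay M T1 T2 epsR epsS delivered d0 by fact
  have T: "T > 0" using T1_pos T2_pos assms(2) by simp
  have "AE w in M. (\<lambda>k. (\<Sum>n<k\<^sup>2. cycle_age T (d0 i) {k. w \<in> delivered i k} n) / real (k\<^sup>2))
      \<longlonglongrightarrow> T / phi"
    using assms(3,4) T
    by (intro AE_average_cycle_age delivered_indep d0_nonneg) (auto simp: delivered_prob)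
  then show ?thesis
    \<comment> \<open>The exceptional null set comes only from the limit along squares; outside it
      the passage to continuous time is deterministic.\<close>
    by eventually_elim (rule average_age_tendsto[OF T d0_nonneg])
qed

end
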